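(* Let $R$ be a commutative Noetherian ring, $A\in R^{n\times n}$, $B\in R^{n\times m}$, and let $M\subseteq R^n$ be a submodule. Let $$\mathcal{M} := \ker\,[\,yE-A,\,-B\,]\ \cap\ \bigl(M[y]\times R[y]^m\bigr)\ \subseteq\ R[y]^{n+m},$$ and let $\pi: R[y]^{n+m}=R[y]^n\oplus R[y]^m\to R[y]^n$ be the projection onto the first $n$ components. If $h_1,\ldots,h_s$ generate $\mathcal{M}$ as an $R[y]$-module, then the family of all coefficient vectors (in $R^n$) of the polynomial vectors $\pi(h_1),\ldots,\pi(h_s)$ generates, as an $R$-module, the maximal reachability submodule $M^*_0$ of $M$.
   Context: Let $R$ be a commutative ring, $A\in R^{n\times n}$, $B\in R^{n\times m}$. A submodule $U\subseteq R^n$ is called $(A,B)$-invariant if $AU\subseteq U+\operatorname{im}B$. An $(A,B)$-invariant submodule $U$ is called reachable, or a reachability submodule, if every state in $U$ can be reached from zero within $U$: for every $x\in U$ there are $r\in\mathbb{N}$ and $u_0,\ldots,u_{r-1}\in R^m$ such that the states defined by $x_0=0$, $x_{k+1}=Ax_k+Bu_k$ (so $x_1=Bu_0,\ \ldots,\ x_r=A^{r-1}Bu_0+\cdots+Bu_{r-1}$) satisfy $x_1,\ldots,x_r\in U$ and $x_r=x$. Sums of reachability submodules are reachability submodules, so every submodule $M$ of $R^n$ contains a unique maximal (largest) reachability submodule, denoted $M^*_0$; it is the sum of all reachability submodules contained in $M$. $R[y]$ is the polynomial ring in one variable, $E$ is the $n\times n$ identity matrix, and $[\,yE-A,\,-B\,]$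 is the $n\times(n+m)$ matrix over $R[y]$ regarded as a map $R[y]^{n+m}\to R[y]^n$, so its kernel consists of the pairs $(f,g)$ with $f\in R[y]^n$, $g\in R[y]^m$ and $(yE-A)f=Bg$. $M[y]$ is the $R[y]$-submodule of $R[y]^n$ consisting of those polynomial vectors all of whose coefficient vectors lie in $M$. The coefficient vectors of $f=\sum_i f_i y^i\in R[y]^n$ are the vectors $f_i\in R^n$. *)

theory Defs
  imports "HOL-Analysis.Cartesian_Space" "HOL-Computational_Algebra.Polynomial"
begin

section \<open>Modules of column vectors over a commutative ring\<close>

text \<open>
  The library interprets \<open>(*s)\<close> only over fields. Over a commutative ring,
  \<open>cvec.subspace\<close> means submodule and \<open>cvec.span\<close> means generated submodule.
  Both are also used over the polynomial ring.
\<close>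

interpretation cvec: module "(*s) :: 'a::comm_ring_1 \<Rightarrow> 'a ^ 'n \<Rightarrow> 'a ^ 'n"
  by unfold_locales (simp_all add: vec_eq_iff algebra_simps)

definition noetherian :: "'a::comm_ring_1 itself \<Rightarrow> bool" where
  "noetherian _ \<longleftrightarrow>
     (\<forall>I :: 'a set. module.subspace (*) I \<longrightarrow> (\<exists>F. finite F \<and> module.span (*) F = I))"


section \<open>Reachability submodules\<close>

definition AB_invariant ::
  "'a::comm_ring_1 ^ 'n ^ 'n \<Rightarrow> 'a ^ 'm ^ 'n \<Rightarrow> ('a ^ 'n) set \<Rightarrow> bool" where
  "AB_invariant A B U \<longleftrightarrow>
     cvec.subspace U \<and> (*v) A ` U \<subseteq> {u + b | u b. u \<in> U \<and> b \<in> range ((*v) B)}"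

primrec state ::
  "'a::comm_ring_1 ^ 'n ^ 'n \<Rightarrow> 'a ^ 'm ^ 'n \<Rightarrow> (nat \<Rightarrow> 'a ^ 'm) \<Rightarrow> nat \<Rightarrow> 'a ^ 'n" where
  "state A B u 0 = 0"
| "state A B u (Suc k) = A *v state A B u k + B *v u k"

text \<open>
  Inputs are infinite sequences; \<open>state A B u r\<close> depends only on \<open>u 0, \<dots>, u (r - 1)\<close>.
\<close>

definition reachability_submodule ::
  "'a::comm_ring_1 ^ 'n ^ 'n \<Rightarrow> 'a ^ 'm ^ 'n \<Rightarrow> ('a ^ 'n) set \<Rightarrow> bool" where
  "reachability_submodule A B U \<longleftrightarrow>
     AB_invariant A B U \<and>
     (\<forall>x\<in>U. \<exists>r u. (\<forall>k\<in>{1..r}. state A B u k \<in> U) \<and> state A B u r = x)"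

text \<open>The sum of a family of submodules is the span of their union.\<close>

definition max_reachability_submodule ::
  "'a::comm_ring_1 ^ 'n ^ 'n \<Rightarrow> 'a ^ 'm ^ 'n \<Rightarrow> ('a ^ 'n) set \<Rightarrow> ('a ^ 'n) set" where
  "max_reachability_submodule A B M =
     cvec.span (\<Union>{U. reachability_submodule A B U \<and> U \<subseteq> M})"

lemma state_add: "state A B (\<lambda>k. u k + v k) k = state A B u k + state A B v k"
  by (induction k) (simp_all add: algebra_simps)

lemma mult_vec_scale:
  fixes A :: "'a::comm_ring_1 ^ 'n ^ 'm"
  shows "A *v (c *s x) = c *s (A *v x)"
  by (simp add: vec_eq_iff matrix_vector_mult_def sum_distrib_left algebra_simps)

lemma state_scale: "state A B (\<lambda>k. c *s u k) k = c *s state A B u k"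
  by (induction k) (simp_all add: mult_vec_scale cvec.scale_right_distrib)

lemma state_delay:
  "state A B (\<lambda>k. if k < d then 0 else u (k - d)) k = (if k < d then 0 else state A B u (k - d))"
proof (induction k)
  case (Suc k)
  then show ?case
    by (cases "Suc k" d rule: linorder_cases) (auto simp: Suc_diff_le)
qed simp

lemma max_reachability_submodule_largest:
  assumes M: "cvec.subspace M"
  shows "reachability_submodule A B (max_reachability_submodule A B M)"
    and "max_reachability_submodule A B M \<subseteq> M"
    and "\<And>U. reachability_submodule A B U \<Longrightarrow> U \<subseteq> M \<Longrightarrow> U \<subseteq> max_reachability_submodule A B M"
proof -
  let ?F = "{U. reachability_submodule A B U \<and> U \<subseteq> M}"
  let ?S = "max_reachability_submodule A B M"
  let ?P = "\<lambda>x. \<exists>r u. (\<forall>k\<in>{1..r}. state A B u k \<in> ?S) \<and> state A B u r = x"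
  let ?Q = "\<lambda>x. \<exists>s\<in>?S. \<exists>w. A *v x = s + B *v w"
  have sub: "cvec.subspace ?S"
    by (simp add: max_reachability_submodule_def)
  show upper: "U \<subseteq> ?S" if "reachability_submodule A B U" "U \<subseteq> M" for U
    unfolding max_reachability_submodule_def
    by (rule order_trans[OF _ cvec.span_superset]) (use that in blast)
  show "?S \<subseteq> M"
    unfolding max_reachability_submodule_def by (rule cvec.span_minimal) (use M in auto)
  have gen: "?P x \<and> ?Q x" if x: "x \<in> U" and U: "U \<in> ?F" for x U
  proof -
    have US: "U \<subseteq> ?S" using U by (simp add: upper)
    from U x obtain r u where "\<forall>k\<in>{1..r}. state A B u k \<in> U" "state A B u r = x"
      unfolding reachability_submodule_def by blast
    with US have P: "?P x" by blast
    from U have "(*v) A ` U \<subseteq> {u + b | u b. u \<in> U \<and> b \<in> range ((*v) B)}"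
      unfolding reachability_submodule_def AB_invariant_def by blast
    with x have "A *v x \<in> {u + b | u b. u \<in> U \<and> b \<in> range ((*v) B)}" by blast
    with US have "?Q x" by blast
    with P show ?thesis by blast
  qed
  have all: "?P x \<and> ?Q x" if "x \<in> ?S" for x
    using that[unfolded max_reachability_submodule_def]
  proof (induction rule: cvec.span_induct_alt)
    case base
    have "?P 0"
      by (rule exI[of _ 0], rule exI[of _ "\<lambda>_. 0"]) simp
    moreover have "?Q 0"
      by (rule bexI[of _ 0], rule exI[of _ 0]) (simp_all add: cvec.subspace_0[OF sub])
    ultimately show ?case by blast
  next
    case (step c x y)
    from step(1) obtain U where U: "x \<in> U" "U \<in> ?F" by (rule UnionE)
    from gen[OF U] obtain r u s w where
      u: "\<forall>k\<in>{1..r}. state A B u k \<in> ?S" "state A B u r = x"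
      and s: "s \<in> ?S" "A *v x = s + B *v w" by blast
    from step(2) obtain r' u' s' w' where
      u': "\<forall>k\<in>{1..r'}. state A B u' k \<in> ?S" "state A B u' r' = y"
      and s': "s' \<in> ?S" "A *v y = s' + B *v w'" by blast
    have S0: "0 \<in> ?S" by (rule cvec.subspace_0[OF sub])
    define p where "p = max r r'"
    define v where "v k = (if k < p - r then 0 else u (k - (p - r)))" for k
    define v' where "v' k = (if k < p - r' then 0 else u' (k - (p - r')))" for k
    have v: "state A B v k = (if k < p - r then 0 else state A B u (k - (p - r)))" for k
      unfolding v_def by (rule state_delay)
    have v': "state A B v' k = (if k < p - r' then 0 else state A B u' (k - (p - r')))" for k
      unfolding v'_def by (rule state_delay)
    have uS: "state A B u j \<in> ?S" if "j \<le> r" for j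
      using u(1) S0 that by (cases "j = 0") auto
    have u'S: "state A B u' j \<in> ?S" if "j \<le> r'" for j
      using u'(1) S0 that by (cases "j = 0") auto
    have vS: "state A B v k \<in> ?S" "state A B v' k \<in> ?S" if "k \<le> p" for k
      using that S0 uS[of "k - (p - r)"] u'S[of "k - (p - r')"]
      by (auto simp: v v' p_def)
    have "state A B (\<lambda>k. c *s v k + v' k) k = c *s state A B v k + state A B v' k" for k
      by (simp add: state_add state_scale)
    moreover have "state A B v p = x" "state A B v' p = y"
      using u(2) u'(2) by (auto simp: v v' p_def)
    ultimately have "(\<forall>k\<in>{1..p}. state A B (\<lambda>k. c *s v k + v' k) k \<in> ?S) \<and>
        state A B (\<lambda>k. c *s v k + v' k) p = c *s x + y"
      using vS by (simp add: cvec.subspace_add[OF sub] cvec.subspace_scale[OF sub])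
    then have "?P (c *s x + y)"
      by (intro exI[of _ p] exI[of _ "\<lambda>k. c *s v k + v' k"])
    have "A *v (c *s x + y) = (c *s s + s') + B *v (c *s w + w')"
      using s s' by (simp add: matrix_vector_right_distrib mult_vec_scale cvec.scale_right_distrib)
    moreover have "c *s s + s' \<in> ?S"
      using s s' by (simp add: cvec.subspace_add[OF sub] cvec.subspace_scale[OF sub])
    ultimately have "?Q (c *s x + y)" by blast
    with \<open>?P (c *s x + y)\<close> show ?case by simp
  qed
  then have "(*v) A ` ?S \<subseteq> {s + b | s b. s \<in> ?S \<and> b \<in> range ((*v) B)}" by blast
  with sub all show "reachability_submodule A B ?S"
    unfolding reachability_submodule_def AB_invariant_def by simp
qed


section \<open>Polynomial vectors\<close>

definition coeff_vec :: "'a::zero poly ^ 'n \<Rightarrow> nat \<Rightarrow> 'a ^ 'n" where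
  "coeff_vec f k = (\<chi> i. coeff (f $ i) k)"

definition poly_extension :: "('a::zero ^ 'n) set \<Rightarrow> ('a poly ^ 'n) set" where
  "poly_extension M = {f. \<forall>k. coeff_vec f k \<in> M}"

text \<open>
  A vector of length \<open>n + m\<close> is indexed by the sum type \<open>'n + 'm\<close>; its first \<open>n\<close>
  components are those with index \<open>Inl i\<close>.
\<close>

definition first_components :: "'b ^ ('n::finite + 'm::finite) \<Rightarrow> 'b ^ 'n" where
  "first_components h = (\<chi> i. h $ Inl i)"

definition block_row :: "'b ^ 'n ^ 'k \<Rightarrow> 'b ^ 'm ^ 'k \<Rightarrow> 'b ^ ('n::finite + 'm::finite) ^ 'k" where
  "block_row X Y = (\<chi> i j. case j of Inl p \<Rightarrow> X $ i $ p | Inr q \<Rightarrow> Y $ i $ q)"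

text \<open>
  The matrix \<open>[yE - A, -B]\<close>. The variable \<open>y\<close> is \<open>monom 1 1\<close>, and \<open>mat y\<close> is \<open>y\<close> times
  the identity matrix.
\<close>

definition pencil ::
  "'a::comm_ring_1 ^ 'n ^ 'n \<Rightarrow> 'a ^ 'm ^ 'n \<Rightarrow> 'a poly ^ ('n::finite + 'm::finite) ^ 'n" where
  "pencil A B =
     block_row (mat (monom 1 1) - map_matrix (\<lambda>a. [:a:]) A) (- map_matrix (\<lambda>b. [:b:]) B)"

definition pencil_kernel_module ::
  "'a::comm_ring_1 ^ 'n ^ 'n \<Rightarrow> 'a ^ 'm ^ 'n \<Rightarrow> ('a ^ 'n) set \<Rightarrow> ('a poly ^ ('n::finite + 'm::finite)) set" where
  "pencil_kernel_module A B M =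
     {h. pencil A B *v h = 0} \<inter> {h. first_components h \<in> poly_extension M}"

end

theory Submission
  imports Defs
begin

text \<open>
  Write \<open>f = \<Sum> f\<^sub>k y^k\<close> and \<open>g = \<Sum> g\<^sub>k y^k\<close>. Comparing coefficients, \<open>(yE - A) f = B g\<close> says
  \<open>f\<^sub>k = A f\<^bsub>k+1\<^esub> + B g\<^bsub>k+1\<^esub>\<close> for all \<open>k\<close>, and \<open>0 = A f\<^sub>0 + B g\<^sub>0\<close>. Read with decreasing \<open>k\<close>, the
  coefficients of \<open>f\<close> are thus a trajectory that starts at zero and returns to zero, and the
  elements of the kernel module correspond to the trajectories of this kind inside \<open>M\<close>
  (\<open>kernel_element_is_trajectory\<close>, \<open>closed_trajectory_coefficients\<close>).

  Let \<open>L\<close> be the set of all coefficient vectors of the first components of kernel elements. As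
  multiplication by powers of \<open>y\<close> aligns coefficients, \<open>L\<close> is already a submodule, and it is
  generated by the coefficients of any set of generators of the kernel module
  (\<open>state_coefficients_span\<close>). The trajectory description shows that \<open>L\<close> is a reachability
  submodule of \<open>M\<close> (\<open>reachability_state_coefficients\<close>).

  For the converse, let \<open>U \<subseteq> M\<close> be a reachability submodule and \<open>x \<in> U\<close>. Some trajectory
  \<open>x\<^sub>0 = 0, \<dots>, x\<^sub>r = x\<close> in \<open>U\<close> reaches \<open>x\<close>, and by invariance it can be continued forever in
  \<open>U\<close>. Since \<open>R\<close> is Noetherian, some \<open>x\<^bsub>r+k\<^esub>\<close> is a combination of
  \<open>x\<^sub>r, \<dots>, x\<^bsub>r+k-1\<^esub>\<close>. The same combination of delayed copies is a trajectory in \<open>U\<close> that meets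
  the original one at time \<open>r + k\<close>, so the difference of the two is a trajectory in \<open>U\<close> that returns
  to zero, and all its states lie in \<open>L\<close>. At time \<open>j\<close> this difference is \<open>x\<^sub>j\<close> minus a
  combination of earlier states, because the copies are strictly delayed; hence every \<open>x\<^sub>j\<close>, and
  in particular \<open>x\<close>, lies in \<open>L\<close> by induction on \<open>j\<close> (\<open>reachability_submodule_subset\<close>).
\<close>

section \<open>Sequences of vectors over a Noetherian ring\<close>

lemma module_mult: "module ((*) :: 'a::comm_ring_1 \<Rightarrow> 'a \<Rightarrow> 'a)"
  by unfold_locales (simp_all add: algebra_simps)

text \<open>
  Induction on the number of coordinates: the values of one coordinate form an ideal, and a
  submodule is generated by lifts of generators of that ideal together with generators of the
  part where this coordinate vanishes.
\<close>

lemma noetherian_finitely_generated_supported: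
  fixes N :: "('a::comm_ring_1 ^ 'n::finite) set"
  assumes noeth: "noetherian TYPE('a)" and "finite I"
  shows "cvec.subspace N \<Longrightarrow> (\<And>v i. v \<in> N \<Longrightarrow> i \<notin> I \<Longrightarrow> v $ i = 0) \<Longrightarrow>
    \<exists>F. finite F \<and> cvec.span F = N"
  using \<open>finite I\<close>
proof (induction I arbitrary: N rule: finite_induct)
  case empty
  then have "N = {0}"
    using cvec.subspace_0[of N] by (auto simp: vec_eq_iff)
  then show ?case
    by (intro exI[of _ "{}"]) simp
next
  case (insert i I)
  interpret R: module "(*) :: 'a \<Rightarrow> 'a \<Rightarrow> 'a" by (rule module_mult)
  note N = insert.prems(1)
  let ?J = "(\<lambda>v. v $ i) ` N"
  have "R.subspace ?J"
  proof (rule R.subspaceI)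
    show "0 \<in> ?J"
      using cvec.subspace_0[OF N] by (rule rev_image_eqI) simp
    show "x + y \<in> ?J" if "x \<in> ?J" "y \<in> ?J" for x y
    proof -
      from that obtain v w where "v \<in> N" "w \<in> N" "x = v $ i" "y = w $ i" by blast
      then show ?thesis
        using cvec.subspace_add[OF N, of v w] by (intro rev_image_eqI[of "v + w"]) simp_all
    qed
    show "c * x \<in> ?J" if "x \<in> ?J" for c x
    proof -
      from that obtain v where "v \<in> N" "x = v $ i" by blast
      then show ?thesis
        using cvec.subspace_scale[OF N, of v c] by (intro rev_image_eqI[of "c *s v"]) simp_all
    qed
  qed
  then obtain F where F: "finite F" "R.span F = ?J"
    using noeth unfolding noetherian_def by blast
  then have "F \<subseteq> ?J" using R.span_superset by blast
  then obtain G where G: "finite G" "G \<subseteq> N" "F = (\<lambda>v. v $ i) ` G"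
    using finite_subset_image[OF F(1)] by metis
  let ?N0 = "N \<inter> {v. v $ i = 0}"
  have "cvec.subspace ?N0"
    using N by (auto simp: cvec.subspace_def)
  moreover have "v $ j = 0" if "v \<in> ?N0" "j \<notin> I" for v j
    using that insert.prems(2)[of v j] by (cases "j = i") auto
  ultimately obtain H where H: "finite H" "cvec.span H = ?N0"
    using insert.IH by meson
  have HN: "H \<subseteq> N" using H(2) cvec.span_superset by blast
  have lift: "\<exists>g\<in>cvec.span G. g $ i = a" if "a \<in> R.span F" for a
    using that
  proof (induction rule: R.span_induct_alt)
    case base
    show ?case by (rule bexI[of _ 0]) (simp_all add: cvec.span_zero)
  next
    case (step c x y)
    then obtain v w where "v \<in> G" "x = v $ i" "w \<in> cvec.span G" "w $ i = y"
      using G(3) by blast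
    then show ?case
      by (intro bexI[of _ "c *s v + w"])
        (simp_all add: cvec.span_add cvec.span_scale cvec.span_base)
  qed
  have "v \<in> cvec.span (G \<union> H)" if v: "v \<in> N" for v
  proof -
    have "v $ i \<in> R.span F" using v F(2) by blast
    then obtain g where g: "g \<in> cvec.span G" "g $ i = v $ i" using lift by blast
    have "g \<in> N" using g(1) G(2) N by (meson cvec.span_minimal subsetD)
    then have "v - g \<in> cvec.span H"
      using v g(2) H(2) by (simp add: cvec.subspace_diff[OF N])
    then have "v - g \<in> cvec.span (G \<union> H)" "g \<in> cvec.span (G \<union> H)"
      using g(1) cvec.span_mono[of H "G \<union> H"] cvec.span_mono[of G "G \<union> H"] by auto
    then show ?thesis
      using cvec.span_add[of "v - g" "G \<union> H" g] by simp
  qed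
  moreover have "cvec.span (G \<union> H) \<subseteq> N"
    using G(2) HN N by (intro cvec.span_minimal) auto
  ultimately show ?case
    using G(1) H(1) by (intro exI[of _ "G \<union> H"]) auto
qed

lemma noetherian_finitely_generated:
  fixes N :: "('a::comm_ring_1 ^ 'n::finite) set"
  assumes "noetherian TYPE('a)" "cvec.subspace N"
  shows "\<exists>F. finite F \<and> cvec.span F = N"
  using noetherian_finitely_generated_supported[OF assms(1) finite[of UNIV] assms(2)] by simp

lemma span_range_initial:
  fixes x :: "nat \<Rightarrow> 'a::comm_ring_1 ^ 'n::finite"
  assumes "v \<in> cvec.span (range x)"
  shows "\<exists>k. v \<in> cvec.span (x ` {..<k})"
  using assms
proof (induction rule: cvec.span_induct_alt)
  case base
  show ?case by (auto simp: cvec.span_zero)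
next
  case (step c v w)
  then obtain i k where "v = x i" "w \<in> cvec.span (x ` {..<k})" by blast
  then have "v \<in> cvec.span (x ` {..<max (Suc i) k})"
    by (intro cvec.span_base) auto
  moreover have "x ` {..<k} \<subseteq> x ` {..<max (Suc i) k}" by auto
  then have "w \<in> cvec.span (x ` {..<max (Suc i) k})"
    using \<open>w \<in> cvec.span (x ` {..<k})\<close> cvec.span_mono by blast
  ultimately show ?case by (blast intro: cvec.span_add cvec.span_scale)
qed

lemma noetherian_sequence_dependent:
  fixes x :: "nat \<Rightarrow> 'a::comm_ring_1 ^ 'n::finite"
  assumes "noetherian TYPE('a)"
  shows "\<exists>k. x k \<in> cvec.span (x ` {..<k})"
proof -
  obtain F where F: "finite F" "cvec.span F = cvec.span (range x)"
    using noetherian_finitely_generated[OF assms cvec.subspace_span] by blast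
  have "\<forall>v\<in>F. \<exists>k. v \<in> cvec.span (x ` {..<k})"
    using F(2) span_range_initial cvec.span_base by blast
  then obtain k where k: "\<And>v. v \<in> F \<Longrightarrow> v \<in> cvec.span (x ` {..<k v})"
    by metis
  define K where "K = (\<Sum>v\<in>F. k v)"
  have "v \<in> cvec.span (x ` {..<K})" if "v \<in> F" for v
  proof -
    have "k v \<le> K" unfolding K_def using F(1) that by (intro member_le_sum) auto
    then have "x ` {..<k v} \<subseteq> x ` {..<K}" by auto
    then show ?thesis using k[OF that] cvec.span_mono by blast
  qed
  then have "cvec.span F \<subseteq> cvec.span (x ` {..<K})"
    by (intro cvec.span_minimal) auto
  moreover have "x K \<in> cvec.span F" using F(2) by (simp add: cvec.span_base)
  ultimately show ?thesis by blast
qed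


section \<open>Coefficient vectors of a module of polynomial vectors\<close>

lemma coeff_vec_zero [simp]: "coeff_vec 0 k = 0"
  by (simp add: coeff_vec_def vec_eq_iff)

lemma coeff_vec_add:
  fixes f g :: "'a::comm_ring_1 poly ^ 'n"
  shows "coeff_vec (f + g) k = coeff_vec f k + coeff_vec g k"
  by (simp add: coeff_vec_def vec_eq_iff)

lemma coeff_vec_scale:
  fixes f :: "'a::comm_ring_1 poly ^ 'n"
  shows "coeff_vec (p *s f) k = (\<Sum>i\<le>k. coeff p i *s coeff_vec f (k - i))"
  by (simp add: coeff_vec_def vec_eq_iff coeff_mult)

lemma coeff_vec_monom_scale:
  fixes f :: "'a::comm_ring_1 poly ^ 'n"
  shows "coeff_vec (monom c d *s f) (k + d) = c *s coeff_vec f k"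
  by (simp add: coeff_vec_def vec_eq_iff coeff_monom_mult)

lemma coeff_vec_eventually_zero:
  fixes f :: "'a::comm_ring_1 poly ^ 'n::finite"
  obtains N where "\<And>k. k \<ge> N \<Longrightarrow> coeff_vec f k = 0"
proof (rule that[of "Suc (\<Sum>i\<in>UNIV. degree (f $ i))"])
  fix k assume k: "k \<ge> Suc (\<Sum>i\<in>UNIV. degree (f $ i))"
  have "degree (f $ j) \<le> (\<Sum>i\<in>UNIV. degree (f $ i))" for j
    by (rule member_le_sum) auto
  then have "degree (f $ j) < k" for j
    using k by (meson Suc_le_lessD le_less_trans)
  then show "coeff_vec f k = 0"
    by (simp add: coeff_vec_def vec_eq_iff coeff_eq_0)
qed

lemma poly_vec_exists:
  fixes a :: "nat \<Rightarrow> 'a::comm_ring_1 ^ 'n"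
  assumes "\<And>k. k > N \<Longrightarrow> a k = 0"
  obtains f where "\<And>k. coeff_vec f k = a k"
proof
  fix k
  show "coeff_vec (\<chi> i. \<Sum>k\<le>N. monom (a k $ i) k) k = a k"
    using assms[of k] by (cases "k \<le> N") (simp_all add: coeff_vec_def vec_eq_iff coeff_sum)
qed

lemma first_components_zero [simp]: "first_components 0 = 0"
  by (simp add: first_components_def vec_eq_iff)

lemma first_components_add:
  fixes h h' :: "'b::comm_ring_1 ^ ('n::finite + 'm::finite)"
  shows "first_components (h + h') = first_components h + first_components h'"
  by (simp add: first_components_def vec_eq_iff)

lemma first_components_scale:
  fixes h :: "'b::comm_ring_1 ^ ('n::finite + 'm::finite)"
  shows "first_components (c *s h) = c *s first_components h"
  by (simp add: first_components_def vec_eq_iff)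

text \<open>
  The set \<open>L\<close> of all coefficient vectors of the first components of elements of \<open>K\<close>; no span is
  taken.
\<close>

definition state_coefficients ::
  "('a::comm_ring_1 poly ^ ('n::finite + 'm::finite)) set \<Rightarrow> ('a ^ 'n) set" where
  "state_coefficients K = {coeff_vec (first_components h) k | h k. h \<in> K}"

lemma state_coefficientsI: "h \<in> K \<Longrightarrow> coeff_vec (first_components h) k \<in> state_coefficients K"
  unfolding state_coefficients_def by blast

lemma subspace_state_coefficients:
  fixes K :: "('a::comm_ring_1 poly ^ ('n::finite + 'm::finite)) set"
  assumes K: "cvec.subspace K"
  shows "cvec.subspace (state_coefficients K)"
proof (rule cvec.subspaceI)
  have "coeff_vec (first_components (0 :: 'a poly ^ ('n + 'm))) 0 \<in> state_coefficients K"
    by (intro state_coefficientsI cvec.subspace_0[OF K])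
  then show "0 \<in> state_coefficients K" by simp
next
  fix x y assume "x \<in> state_coefficients K" "y \<in> state_coefficients K"
  then obtain h k h' k' where h: "h \<in> K" "x = coeff_vec (first_components h) k"
    and h': "h' \<in> K" "y = coeff_vec (first_components h') k'"
    unfolding state_coefficients_def by blast
  \<comment> \<open>Shifting by powers of the variable moves both coefficients to degree \<open>k + k'\<close>.\<close>
  let ?h = "monom 1 k' *s h + monom 1 k *s h'"
  have "?h \<in> K"
    by (intro cvec.subspace_add[OF K] cvec.subspace_scale[OF K] h h')
  moreover have "coeff_vec (first_components ?h) (k + k') = x + y"
    using coeff_vec_monom_scale[of 1 k' "first_components h" k]
      coeff_vec_monom_scale[of 1 k "first_components h'" k']
    by (simp add: first_components_add first_components_scale coeff_vec_add h h' add.commute)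
  ultimately show "x + y \<in> state_coefficients K"
    by (metis state_coefficientsI)
next
  fix c x assume "x \<in> state_coefficients K"
  then obtain h k where h: "h \<in> K" "x = coeff_vec (first_components h) k"
    unfolding state_coefficients_def by blast
  have "monom c 0 *s h \<in> K" by (rule cvec.subspace_scale[OF K h(1)])
  moreover have "coeff_vec (first_components (monom c 0 *s h)) k = c *s x"
    using coeff_vec_monom_scale[of c 0 "first_components h" k]
    by (simp add: first_components_scale h)
  ultimately show "c *s x \<in> state_coefficients K"
    by (metis state_coefficientsI)
qed

lemma state_coefficients_span:
  "state_coefficients (cvec.span H) = cvec.span {coeff_vec (first_components h) k | h k. h \<in> H}"
  (is "?L = cvec.span ?C")
proof
  have "coeff_vec (first_components h) k \<in> cvec.span ?C" if "h \<in> cvec.span H" for h k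
    using that
  proof (induction arbitrary: k rule: cvec.span_induct_alt)
    case base
    show ?case by (simp add: cvec.span_zero)
  next
    case (step p h h')
    have "coeff_vec (first_components h) j \<in> cvec.span ?C" for j
      using step(1) by (intro cvec.span_base) blast
    then have "coeff_vec (first_components (p *s h)) k \<in> cvec.span ?C"
      by (auto simp: first_components_scale coeff_vec_scale
          intro!: cvec.span_sum cvec.span_scale)
    then show ?case
      unfolding first_components_add coeff_vec_add by (intro cvec.span_add step)
  qed
  then show "?L \<subseteq> cvec.span ?C"
    unfolding state_coefficients_def by blast
  have "?C \<subseteq> ?L"
    unfolding state_coefficients_def using cvec.span_superset by blast
  then show "cvec.span ?C \<subseteq> ?L"
    by (intro cvec.span_minimal subspace_state_coefficients cvec.subspace_span)
qed


section \<open>Kernel elements as trajectories from zero to zero\<close>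

text \<open>The last \<open>m\<close> components, complementary to \<open>first_components\<close>: the polynomial of inputs.\<close>

definition last_components :: "'b ^ ('n::finite + 'm::finite) \<Rightarrow> 'b ^ 'm" where
  "last_components h = (\<chi> j. h $ Inr j)"

lemma sum_UNIV_Plus:
  fixes f :: "'n::finite + 'm::finite \<Rightarrow> 'b::comm_monoid_add"
  shows "sum f UNIV = (\<Sum>p\<in>UNIV. f (Inl p)) + (\<Sum>q\<in>UNIV. f (Inr q))"
  by (simp add: UNIV_Plus_UNIV[symmetric] sum.Plus del: UNIV_Plus_UNIV)

lemma pencil_mult:
  fixes A :: "'a::comm_ring_1 ^ 'n::finite ^ 'n" and B :: "'a ^ 'm::finite ^ 'n"
  shows "pencil A B *v h = monom 1 1 *s first_components h
    - map_matrix (\<lambda>a. [:a:]) A *v first_components h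
    - map_matrix (\<lambda>b. [:b:]) B *v last_components h"
proof -
  have "pencil A B *v h = (mat (monom 1 1) - map_matrix (\<lambda>a. [:a:]) A) *v first_components h
    - map_matrix (\<lambda>b. [:b:]) B *v last_components h"
    by (simp add: vec_eq_iff pencil_def block_row_def matrix_vector_mult_def sum_UNIV_Plus
        first_components_def last_components_def sum_negf)
  moreover have "mat (monom 1 1) *v first_components h = monom 1 1 *s first_components h"
    by (simp add: vec_eq_iff matrix_vector_mult_def mat_def if_distrib[of "\<lambda>x. x * _"]
        cong: if_cong)
  ultimately show ?thesis
    by (simp add: matrix_vector_mult_diff_rdistrib)
qed

lemma coeff_vec_const_mult:
  fixes A :: "'a::comm_ring_1 ^ 'n::finite ^ 'k"
  shows "coeff_vec (map_matrix (\<lambda>a. [:a:]) A *v f) k = A *v coeff_vec f k"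
  by (simp add: vec_eq_iff coeff_vec_def matrix_vector_mult_def map_matrix_def coeff_sum)

lemma coeff_vec_diff:
  fixes f g :: "'a::comm_ring_1 poly ^ 'n"
  shows "coeff_vec (f - g) k = coeff_vec f k - coeff_vec g k"
  by (simp add: coeff_vec_def vec_eq_iff)

lemma coeff_vec_eq_0_iff:
  fixes f :: "'a::comm_ring_1 poly ^ 'n"
  shows "f = 0 \<longleftrightarrow> (\<forall>k. coeff_vec f k = 0)"
  by (auto simp: coeff_vec_def vec_eq_iff poly_eq_iff)

lemma coeff_vec_shift:
  fixes f :: "'a::comm_ring_1 poly ^ 'n"
  shows "coeff_vec (monom 1 1 *s f) k = (case k of 0 \<Rightarrow> 0 | Suc j \<Rightarrow> coeff_vec f j)"
  by (auto simp: coeff_vec_def vec_eq_iff coeff_monom_mult split: nat.split)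

lemma pencil_kernel_iff:
  fixes A :: "'a::comm_ring_1 ^ 'n::finite ^ 'n" and B :: "'a ^ 'm::finite ^ 'n"
  shows "pencil A B *v h = 0 \<longleftrightarrow>
    (\<forall>k. (case k of 0 \<Rightarrow> 0 | Suc j \<Rightarrow> coeff_vec (first_components h) j) =
      A *v coeff_vec (first_components h) k + B *v coeff_vec (last_components h) k)"
  unfolding coeff_vec_eq_0_iff pencil_mult coeff_vec_diff coeff_vec_const_mult coeff_vec_shift
  by (simp only: diff_diff_eq eq_iff_diff_eq_0[symmetric])

lemma subspace_pencil_kernel_module:
  fixes A :: "'a::comm_ring_1 ^ 'n::finite ^ 'n" and B :: "'a ^ 'm::finite ^ 'n"
  assumes M: "cvec.subspace M"
  shows "cvec.subspace (pencil_kernel_module A B M)"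
  by (rule cvec.subspaceI)
    (auto simp: pencil_kernel_module_def poly_extension_def first_components_add
      first_components_scale coeff_vec_add coeff_vec_scale matrix_vector_right_distrib
      mult_vec_scale intro!: cvec.subspace_0[OF M] cvec.subspace_add[OF M]
      cvec.subspace_sum[OF M] cvec.subspace_scale[OF M])

lemma kernel_element_is_trajectory:
  fixes A :: "'a::comm_ring_1 ^ 'n::finite ^ 'n" and B :: "'a ^ 'm::finite ^ 'n"
  assumes h: "pencil A B *v h = 0"
    and N: "coeff_vec (first_components h) N = 0" and "j \<le> N"
  shows "state A B (\<lambda>i. coeff_vec (last_components h) (N - i)) j =
    coeff_vec (first_components h) (N - j)"
  using \<open>j \<le> N\<close>
proof (induction j)
  case 0
  show ?case by (simp add: N)
next
  case (Suc j)
  then have "N - j = Suc (N - Suc j)" by simp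
  then show ?case
    using h[unfolded pencil_kernel_iff, rule_format, of "N - j"] Suc by simp
qed

lemma closed_trajectory_coefficients:
  fixes A :: "'a::comm_ring_1 ^ 'n::finite ^ 'n" and B :: "'a ^ 'm::finite ^ 'n"
  assumes M: "\<And>k. k \<le> N \<Longrightarrow> state A B u k \<in> M" and end0: "state A B u N = 0" and "j \<le> N"
  shows "state A B u j \<in> state_coefficients (pencil_kernel_module A B M)"
proof -
  obtain f where f: "\<And>k. coeff_vec f k = (if k \<le> N then state A B u (N - k) else 0)"
    using poly_vec_exists[of N "\<lambda>k. if k \<le> N then state A B u (N - k) else 0"] by auto
  \<comment> \<open>The input in degree 0 would act after the final time \<open>N\<close>, where the state is already zero.\<close>
  obtain g where g: "\<And>k. coeff_vec g k = (if 0 < k \<and> k \<le> N then u (N - k) else 0)"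
    using poly_vec_exists[of N "\<lambda>k. if 0 < k \<and> k \<le> N then u (N - k) else 0"] by auto
  define h :: "'a poly ^ ('n + 'm)" where
    "h = (\<chi> i. case i of Inl p \<Rightarrow> f $ p | Inr q \<Rightarrow> g $ q)"
  have fh: "first_components h = f" and gh: "last_components h = g"
    by (simp_all add: h_def first_components_def last_components_def vec_eq_iff)
  have "(case k of 0 \<Rightarrow> 0 | Suc j \<Rightarrow> coeff_vec f j) = A *v coeff_vec f k + B *v coeff_vec g k" for k
  proof (cases k)
    case 0
    then show ?thesis by (simp add: f g end0)
  next
    case (Suc i)
    then have "state A B u (N - i) = A *v state A B u (N - k) + B *v u (N - k)" if "k \<le> N"
      using that by (metis Suc_diff_le diff_Suc_Suc state.simps(2))
    then show ?thesis
      using Suc by (cases "i = N") (auto simp: f g)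
  qed
  moreover have "0 \<in> M" using M[of N] end0 by simp
  then have "f \<in> poly_extension M"
    by (simp add: poly_extension_def f M)
  ultimately have "h \<in> pencil_kernel_module A B M"
    unfolding pencil_kernel_module_def Int_iff mem_Collect_eq pencil_kernel_iff fh gh by blast
  moreover have "coeff_vec (first_components h) (N - j) = state A B u j"
    using \<open>j \<le> N\<close> by (simp add: fh f)
  ultimately show ?thesis
    by (metis state_coefficientsI)
qed


section \<open>The coefficient vectors form the largest reachability submodule\<close>

lemma reachability_state_coefficients:
  fixes A :: "'a::comm_ring_1 ^ 'n::finite ^ 'n" and B :: "'a ^ 'm::finite ^ 'n"
  assumes M: "cvec.subspace M"
  shows "reachability_submodule A B (state_coefficients (pencil_kernel_module A B M))"
    (is "reachability_submodule A B ?L")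
proof -
  have L: "cvec.subspace ?L"
    by (intro subspace_state_coefficients subspace_pencil_kernel_module M)
  have "\<exists>v\<in>?L. \<exists>w. A *v x = v + B *v w" if "x \<in> ?L" for x
  proof -
    from that obtain h k where h: "h \<in> pencil_kernel_module A B M"
      and x: "x = coeff_vec (first_components h) k"
      unfolding state_coefficients_def by blast
    let ?v = "case k of 0 \<Rightarrow> 0 | Suc j \<Rightarrow> coeff_vec (first_components h) j"
    have "?v \<in> ?L"
      by (cases k) (simp_all add: cvec.subspace_0[OF L] state_coefficientsI h)
    moreover have "?v = A *v x + B *v coeff_vec (last_components h) k"
      using h by (simp add: pencil_kernel_module_def pencil_kernel_iff x)
    then have "A *v x = ?v + B *v (- 1 *s coeff_vec (last_components h) k)"
      unfolding mult_vec_scale by simp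
    ultimately show ?thesis by blast
  qed
  then have "(*v) A ` ?L \<subseteq> {v + b | v b. v \<in> ?L \<and> b \<in> range ((*v) B)}" by blast
  moreover have "\<exists>r u. (\<forall>k\<in>{1..r}. state A B u k \<in> ?L) \<and> state A B u r = x" if "x \<in> ?L" for x
  proof -
    from that obtain h k where h: "h \<in> pencil_kernel_module A B M"
      and x: "x = coeff_vec (first_components h) k"
      unfolding state_coefficients_def by blast
    obtain N0 where N0: "\<And>k. k \<ge> N0 \<Longrightarrow> coeff_vec (first_components h) k = 0"
      by (rule coeff_vec_eventually_zero) blast
    define N where "N = max N0 k"
    have "state A B (\<lambda>i. coeff_vec (last_components h) (N - i)) j =
        coeff_vec (first_components h) (N - j)" if "j \<le> N" for j
      using h that by (intro kernel_element_is_trajectory)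
        (simp_all add: pencil_kernel_module_def N0 N_def)
    then show ?thesis
      by (intro exI[of _ "N - k"] exI[of _ "\<lambda>i. coeff_vec (last_components h) (N - i)"])
        (auto simp: state_coefficientsI h x N_def)
  qed
  ultimately show ?thesis
    using L unfolding reachability_submodule_def AB_invariant_def by blast
qed

text \<open>The continuation stays in \<open>U\<close> for all times, but in general does not return to zero.\<close>

lemma invariant_trajectory_extension:
  fixes A :: "'a::comm_ring_1 ^ 'n::finite ^ 'n" and B :: "'a ^ 'm::finite ^ 'n"
  assumes U: "AB_invariant A B U" and u: "\<And>k. k \<le> r \<Longrightarrow> state A B u k \<in> U"
  obtains v where "state A B v r = state A B u r" "\<And>k. state A B v k \<in> U"
proof -
  have "\<exists>w. A *v x + B *v w \<in> U" if "x \<in> U" for x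
  proof -
    have "A *v x \<in> {s + b | s b. s \<in> U \<and> b \<in> range ((*v) B)}"
      using U that unfolding AB_invariant_def by blast
    then obtain s w where "s \<in> U" "A *v x = s + B *v w" by blast
    then have "A *v x + B *v (- 1 *s w) \<in> U"
      unfolding mult_vec_scale by simp
    then show ?thesis by blast
  qed
  then obtain \<phi> where \<phi>: "\<And>x. x \<in> U \<Longrightarrow> A *v x + B *v \<phi> x \<in> U" by metis
  define z where "z k = ((\<lambda>x. A *v x + B *v \<phi> x) ^^ k) (state A B u r)" for k
  have z: "z k \<in> U" for k
    by (induction k) (simp_all add: z_def \<phi> u)
  define v where "v k = (if k < r then u k else \<phi> (z (k - r)))" for k
  have v1: "state A B v k = state A B u k" if "k \<le> r" for k
    using that by (induction k) (simp_all add: v_def)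
  have v2: "state A B v (r + k) = z k" for k
  proof (induction k)
    case 0
    show ?case by (simp add: v1 z_def)
  next
    case (Suc k)
    then show ?case by (simp add: v_def z_def)
  qed
  have "state A B v k \<in> U" for k
    using v1[of k] v2[of "k - r"] u[of k] z[of "k - r"] by (cases "k \<le> r") auto
  with v1[of r] show thesis by (intro that[of v]) auto
qed

text \<open>
  A combination of states at times \<open>r, \<dots>, r + k - 1\<close> is also reached at time \<open>r + k\<close>, by a
  combination of delayed copies of the trajectory. All delays are positive, so each
  state of the new trajectory depends only on strictly earlier states of the old one.
\<close>

lemma delayed_combination:
  fixes A :: "'a::comm_ring_1 ^ 'n::finite ^ 'n" and B :: "'a ^ 'm::finite ^ 'n"
  assumes "w \<in> cvec.span ((\<lambda>i. state A B v (r + i)) ` {..<k})"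
  shows "\<exists>u. state A B u (r + k) = w \<and>
    (\<forall>j. state A B u j \<in> cvec.span (state A B v ` {..<j}))"
  using assms
proof (induction rule: cvec.span_induct_alt)
  case base
  have "state A B (\<lambda>_. 0) j = 0" for j by (induction j) simp_all
  then show ?case by (intro exI[of _ "\<lambda>_. 0"]) (simp add: cvec.span_zero)
next
  case (step c x y)
  from step(1) obtain i where i: "i < k" "x = state A B v (r + i)" by blast
  from step(2) obtain u where u: "state A B u (r + k) = y"
    "\<And>j. state A B u j \<in> cvec.span (state A B v ` {..<j})" by blast
  define d where "d = k - i"
  define v' where "v' j = (if j < d then 0 else v (j - d))" for j
  have v': "state A B v' j = (if j < d then 0 else state A B v (j - d))" for j
    unfolding v'_def by (rule state_delay)
  have "state A B v' j \<in> cvec.span (state A B v ` {..<j})" for j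
  proof (cases "j < d")
    case False
    then have "j - d < j" using i(1) by (simp add: d_def)
    with False show ?thesis by (simp add: v' cvec.span_base)
  qed (simp add: v' cvec.span_zero)
  moreover have "state A B v' (r + k) = x"
    using i by (simp add: v' d_def)
  ultimately show ?case
    by (intro exI[of _ "\<lambda>j. c *s v' j + u j"])
      (simp add: state_add state_scale u cvec.span_add cvec.span_scale)
qed

lemma reachability_submodule_subset:
  fixes A :: "'a::comm_ring_1 ^ 'n::finite ^ 'n" and B :: "'a ^ 'm::finite ^ 'n"
  assumes noeth: "noetherian TYPE('a)" and M: "cvec.subspace M"
    and U: "reachability_submodule A B U" and "U \<subseteq> M"
  shows "U \<subseteq> state_coefficients (pencil_kernel_module A B M)" (is "U \<subseteq> ?L")
proof
  fix x assume "x \<in> U"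
  have inv: "AB_invariant A B U" and sub: "cvec.subspace U"
    using U by (simp_all add: reachability_submodule_def AB_invariant_def)
  obtain r u where u: "\<And>k. k \<in> {1..r} \<Longrightarrow> state A B u k \<in> U" "state A B u r = x"
    using U \<open>x \<in> U\<close> unfolding reachability_submodule_def by blast
  have "state A B u k \<in> U" if "k \<le> r" for k
    using that u(1)[of k] by (cases "k = 0") (auto simp: cvec.subspace_0[OF sub])
  then obtain v where v: "state A B v r = x" "\<And>k. state A B v k \<in> U"
    using invariant_trajectory_extension[OF inv, of r u] u(2) by metis
  obtain k where "state A B v (r + k) \<in> cvec.span ((\<lambda>i. state A B v (r + i)) ` {..<k})"
    using noetherian_sequence_dependent[OF noeth, of "\<lambda>i. state A B v (r + i)"] by blast
  then obtain w where w: "state A B w (r + k) = state A B v (r + k)"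
    "\<And>j. state A B w j \<in> cvec.span (state A B v ` {..<j})"
    using delayed_combination by blast
  have wU: "state A B w j \<in> U" for j
  proof -
    have "cvec.span (state A B v ` {..<j}) \<subseteq> U"
      using v(2) sub by (intro cvec.span_minimal) auto
    then show ?thesis using w(2) by blast
  qed
  define d where "d = (\<lambda>j. v j + - 1 *s w j)"
  have d: "state A B d j = state A B v j - state A B w j" for j
    unfolding d_def state_add state_scale by simp
  have dM: "state A B d j \<in> M" for j
    using cvec.subspace_diff[OF sub v(2) wU] \<open>U \<subseteq> M\<close> by (auto simp: d)
  have dL: "state A B d j \<in> ?L" if "j \<le> r + k" for j
    by (rule closed_trajectory_coefficients[OF dM _ that]) (simp add: d w(1))
  have L: "cvec.subspace ?L"
    by (intro subspace_state_coefficients subspace_pencil_kernel_module M)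
  have "state A B v j \<in> ?L" if "j \<le> r + k" for j
    using that
  proof (induction j rule: less_induct)
    case (less j)
    then have "cvec.span (state A B v ` {..<j}) \<subseteq> ?L"
      using L by (intro cvec.span_minimal) auto
    then have "state A B d j + state A B w j \<in> ?L"
      using w(2)[of j] dL[of j] less.prems by (intro cvec.subspace_add[OF L]) auto
    then show ?case by (simp add: d)
  qed
  then show "x \<in> ?L" using v(1) by force
qed

theorem mainTheorem1:
  fixes A :: "'a::comm_ring_1 ^ 'n ^ 'n"
    and B :: "'a ^ 'm ^ 'n"
    and M :: "('a ^ 'n) set"
    and h :: "nat \<Rightarrow> 'a poly ^ ('n::finite + 'm::finite)"
    and s :: nat
  assumes "noetherian TYPE('a)"
    and "cvec.subspace M"
    and "cvec.span (h ` {1..s}) = pencil_kernel_module A B M"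
  shows "cvec.span {coeff_vec (first_components (h i)) k | i k. i \<in> {1..s}}
           = max_reachability_submodule A B M"
proof -
  let ?L = "state_coefficients (pencil_kernel_module A B M)"
  have "{coeff_vec (first_components (h i)) k | i k. i \<in> {1..s}} =
      {coeff_vec (first_components g) k | g k. g \<in> h ` {1..s}}" by blast
  then have "cvec.span {coeff_vec (first_components (h i)) k | i k. i \<in> {1..s}} = ?L"
    using state_coefficients_span[of "h ` {1..s}"] assms(3) by simp
  moreover have "?L \<subseteq> M"
    by (auto simp: state_coefficients_def pencil_kernel_module_def poly_extension_def)
  then have "?L \<subseteq> max_reachability_submodule A B M"
    by (intro max_reachability_submodule_largest(3) assms(2) reachability_state_coefficients)
  moreover have "max_reachability_submodule A B M \<subseteq> ?L"
    by (intro reachability_submodule_subset assms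
        max_reachability_submodule_largest(1,2)[OF assms(2)])
  ultimately show ?thesis by blast
qed

end
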